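(* There exists a Banach space with a $2$-unconditional basis whose dual fails the ball-covering property (BCP).
   Context: All Banach spaces are real. A Schauder basis $(e_n)$ of $X$ is $K$-unconditional ($K\ge1$) if $\left\|\sum_n a_ne_n\right\|\le K\left\|\sum_n b_ne_n\right\|$ for all finitely supported scalar sequences $(a_n),(b_n)$ with $|a_n|\le|b_n|$ for every $n$. A Banach space $Z$ with unit sphere $S_Z$ has the BCP if there is a countable collection of open balls $\{B(z_n,r_n)\}$ (center $z_n$, radius $r_n>0$) with $S_Z\subset\bigcup_n B(z_n,r_n)$ and $\|z_n\|\ge r_n$ for all $n$. *)

theory Defs
  imports "HOL-Analysis.Analysis" "HOL-Library.Function_Algebras"
begin

text \<open>
  A real normed space is represented by a linear subspace \<open>X\<close> of an ambient real vector space
  together with a function \<open>N\<close> that is a norm on \<open>X\<close>; the values of \<open>N\<close> outside \<open>X\<close> are irrelevant.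
  The ambient type carries no topology, so every real Banach space whose algebraic dimension is at
  most that of the ambient type is covered, up to linear isometry.  In particular, the ambient
  type \<open>nat \<Rightarrow> real\<close>, whose dimension is the cardinality of the continuum, accommodates every
  separable Banach space, hence every Banach space with a Schauder basis.
\<close>

instantiation "fun" :: (type, real_vector) real_vector
begin

definition scaleR_fun :: "real \<Rightarrow> ('a \<Rightarrow> 'b) \<Rightarrow> 'a \<Rightarrow> 'b"
  where "scaleR_fun c f = (\<lambda>x. c *\<^sub>R f x)"

instance
  by standard (simp_all add: scaleR_fun_def fun_eq_iff algebra_simps)

end

definition normed_space_on :: "'a::real_vector set \<Rightarrow> ('a \<Rightarrow> real) \<Rightarrow> bool" where
  "normed_space_on X N \<longleftrightarrow>
     subspace X \<and>
     (\<forall>x\<in>X. 0 \<le> N x) \<and>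
     (\<forall>x\<in>X. N x = 0 \<longleftrightarrow> x = 0) \<and>
     (\<forall>c. \<forall>x\<in>X. N (c *\<^sub>R x) = \<bar>c\<bar> * N x) \<and>
     (\<forall>x\<in>X. \<forall>y\<in>X. N (x + y) \<le> N x + N y)"

text \<open>The library's metric spaces require symmetry and non-negativity of the distance on the whole
  type, hence the default value outside \<open>X\<close>.\<close>

definition ndist :: "'a::real_vector set \<Rightarrow> ('a \<Rightarrow> real) \<Rightarrow> 'a \<Rightarrow> 'a \<Rightarrow> real" where
  "ndist X N x y = (if x \<in> X \<and> y \<in> X then N (x - y) else 0)"

lemma Metric_space_ndist:
  assumes "normed_space_on X N"
  shows "Metric_space X (ndist X N)"
proof
  have sub: "x - y \<in> X" if "x \<in> X" "y \<in> X" for x y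
    using assms that by (simp add: normed_space_on_def subspace_diff)
  have homogeneous: "N (c *\<^sub>R x) = \<bar>c\<bar> * N x" if "x \<in> X" for c x
    using assms that by (simp add: normed_space_on_def)
  have triangle: "N (x + y) \<le> N x + N y" if "x \<in> X" "y \<in> X" for x y
    using assms that by (simp add: normed_space_on_def)
  show "0 \<le> ndist X N x y" for x y
    using assms sub by (auto simp: ndist_def normed_space_on_def)
  show "ndist X N x y = ndist X N y x" for x y
  proof (cases "x \<in> X \<and> y \<in> X")
    case True
    then have "N ((-1) *\<^sub>R (x - y)) = \<bar>-1\<bar> * N (x - y)"
      using homogeneous[OF sub] by blast
    with True show ?thesis by (simp add: ndist_def)
  qed (auto simp: ndist_def)
  show "(ndist X N x y = 0) = (x = y)" if "x \<in> X" "y \<in> X" for x y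
    using assms sub that by (auto simp: ndist_def normed_space_on_def)
  show "ndist X N x z \<le> ndist X N x y + ndist X N y z"
    if "x \<in> X" "y \<in> X" "z \<in> X" for x y z
  proof -
    have "N ((x - y) + (y - z)) \<le> N (x - y) + N (y - z)"
      using that by (intro triangle sub)
    with that show ?thesis by (simp add: ndist_def)
  qed
qed

definition banach_space_on :: "'a::real_vector set \<Rightarrow> ('a \<Rightarrow> real) \<Rightarrow> bool" where
  "banach_space_on X N \<longleftrightarrow>
     normed_space_on X N \<and> Metric_space.mcomplete X (ndist X N)"

definition schauder_basis_on ::
    "'a::real_vector set \<Rightarrow> ('a \<Rightarrow> real) \<Rightarrow> (nat \<Rightarrow> 'a) \<Rightarrow> bool" where
  "schauder_basis_on X N e \<longleftrightarrow>
     range e \<subseteq> X \<and>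
     (\<forall>x\<in>X. \<exists>!a :: nat \<Rightarrow> real. (\<lambda>n. N (x - (\<Sum>i<n. a i *\<^sub>R e i))) \<longlonglongrightarrow> 0)"

definition unconditional_basis_on ::
    "'a::real_vector set \<Rightarrow> ('a \<Rightarrow> real) \<Rightarrow> real \<Rightarrow> (nat \<Rightarrow> 'a) \<Rightarrow> bool" where
  "unconditional_basis_on X N K e \<longleftrightarrow>
     schauder_basis_on X N e \<and> 1 \<le> K \<and>
     (\<forall>a b :: nat \<Rightarrow> real.
        finite {n. a n \<noteq> 0} \<and> finite {n. b n \<noteq> 0} \<and> (\<forall>n. \<bar>a n\<bar> \<le> \<bar>b n\<bar>) \<longrightarrow>
        N (\<Sum>n | a n \<noteq> 0. a n *\<^sub>R e n) \<le> K * N (\<Sum>n | b n \<noteq> 0. b n *\<^sub>R e n))"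

text \<open>Bounded linear functionals on \<open>X\<close> are extended by \<open>0\<close> outside \<open>X\<close>, so that each functional on
  \<open>X\<close> has exactly one representative; the representatives form a subspace of \<open>'a \<Rightarrow> real\<close>.\<close>

definition dual_space :: "'a::real_vector set \<Rightarrow> ('a \<Rightarrow> real) \<Rightarrow> ('a \<Rightarrow> real) set" where
  "dual_space X N =
     {f. (\<forall>x. x \<notin> X \<longrightarrow> f x = 0) \<and>
         (\<forall>x\<in>X. \<forall>y\<in>X. f (x + y) = f x + f y) \<and>
         (\<forall>c. \<forall>x\<in>X. f (c *\<^sub>R x) = c * f x) \<and>
         (\<exists>C. \<forall>x\<in>X. \<bar>f x\<bar> \<le> C * N x)}"

definition dual_norm :: "'a::real_vector set \<Rightarrow> ('a \<Rightarrow> real) \<Rightarrow> ('a \<Rightarrow> real) \<Rightarrow> real" where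
  "dual_norm X N f = (SUP x \<in> {x \<in> X. N x \<le> 1}. \<bar>f x\<bar>)"

lemma normed_space_on_dual:
  assumes "normed_space_on X N"
  shows "normed_space_on (dual_space X N) (dual_norm X N)"
proof -
  let ?D = "dual_space X N" and ?n = "dual_norm X N" and ?U = "{x \<in> X. N x \<le> 1}"
  have nn: "0 \<le> N x" if "x \<in> X" for x
    using assms that by (simp add: normed_space_on_def)
  have zero: "0 \<in> X" "N 0 = 0"
    using assms by (auto simp: normed_space_on_def subspace_0)
  have bound: "\<exists>C. \<forall>x\<in>X. \<bar>f x\<bar> \<le> C * N x" if "f \<in> ?D" for f
    using that unfolding dual_space_def by blast
  have upper: "\<bar>f x\<bar> \<le> ?n f" if "f \<in> ?D" "x \<in> ?U" for f x
  proof -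
    obtain C where C: "\<And>x. x \<in> X \<Longrightarrow> \<bar>f x\<bar> \<le> C * N x"
      using bound[OF \<open>f \<in> ?D\<close>] by blast
    have "\<bar>f y\<bar> \<le> \<bar>C\<bar>" if "y \<in> ?U" for y
    proof -
      have "C * N y \<le> \<bar>C\<bar> * 1"
        using that nn by (intro mult_mono) auto
      with C[of y] that show ?thesis by simp
    qed
    then have "bdd_above ((\<lambda>x. \<bar>f x\<bar>) ` ?U)"
      by (intro bdd_aboveI[of _ "\<bar>C\<bar>"]) auto
    then show ?thesis
      unfolding dual_norm_def using that by (intro cSUP_upper)
  qed
  have least: "?n f \<le> c" if "\<And>x. x \<in> ?U \<Longrightarrow> \<bar>f x\<bar> \<le> c" for f c
    unfolding dual_norm_def using zero that by (intro cSUP_least) auto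
  have nonneg: "0 \<le> ?n f" if "f \<in> ?D" for f
    using upper[OF that, of 0] zero by simp
  have add: "f + g \<in> ?D" if "f \<in> ?D" "g \<in> ?D" for f g
  proof -
    obtain C C' where C: "\<And>x. x \<in> X \<Longrightarrow> \<bar>f x\<bar> \<le> C * N x" and C': "\<And>x. x \<in> X \<Longrightarrow> \<bar>g x\<bar> \<le> C' * N x"
      using bound[OF \<open>f \<in> ?D\<close>] bound[OF \<open>g \<in> ?D\<close>] by blast
    have "\<bar>(f + g) x\<bar> \<le> (C + C') * N x" if "x \<in> X" for x
      using C[OF that] C'[OF that] by (simp add: distrib_right)
    then have "\<exists>C. \<forall>x\<in>X. \<bar>(f + g) x\<bar> \<le> C * N x" by blast
    with that show ?thesis by (simp add: dual_space_def algebra_simps)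
  qed
  have scale: "c *\<^sub>R f \<in> ?D" if "f \<in> ?D" for c f
  proof -
    obtain C where C: "\<And>x. x \<in> X \<Longrightarrow> \<bar>f x\<bar> \<le> C * N x"
      using bound[OF \<open>f \<in> ?D\<close>] by blast
    have "\<bar>(c *\<^sub>R f) x\<bar> \<le> (\<bar>c\<bar> * C) * N x" if "x \<in> X" for x
      using mult_left_mono[OF C[OF that], of "\<bar>c\<bar>"]
      by (simp add: scaleR_fun_def abs_mult mult.assoc)
    then have "\<exists>C. \<forall>x\<in>X. \<bar>(c *\<^sub>R f) x\<bar> \<le> C * N x" by blast
    with that show ?thesis by (simp add: dual_space_def scaleR_fun_def algebra_simps)
  qed
  have zeroD: "0 \<in> ?D"
    by (auto simp: dual_space_def intro: exI[of _ 0])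
  have norm0: "?n 0 = 0"
    using least[of 0 0] nonneg[OF zeroD] by simp
  have definite: "f = 0" if "f \<in> ?D" "?n f = 0" for f
  proof
    fix x
    show "f x = 0 x"
    proof (cases "x \<in> X \<and> x \<noteq> 0")
      case True
      then have "N x > 0"
        using assms nn[of x] by (auto simp: normed_space_on_def less_le)
      with True assms have "(1 / N x) *\<^sub>R x \<in> ?U"
        by (simp add: normed_space_on_def subspace_scale)
      with upper[OF that(1)] that(2) have "f ((1 / N x) *\<^sub>R x) = 0" by force
      moreover have "f ((1 / N x) *\<^sub>R x) = 1 / N x * f x"
        using that(1) True unfolding dual_space_def by blast
      ultimately show ?thesis using \<open>N x > 0\<close> by simp
    next
      case False
      moreover have "f (0 *\<^sub>R 0) = 0 * f 0"
        using that(1) zero unfolding dual_space_def by blast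
      ultimately show ?thesis
        using that(1) by (auto simp: dual_space_def)
    qed
  qed
  have homogeneous: "?n (c *\<^sub>R f) = \<bar>c\<bar> * ?n f" if "f \<in> ?D" for c f
  proof (cases "c = 0")
    case False
    have le: "?n (d *\<^sub>R g) \<le> \<bar>d\<bar> * ?n g" if "g \<in> ?D" for d g
      using upper[OF that]
      by (intro least) (auto simp: scaleR_fun_def abs_mult intro!: mult_left_mono)
    have "?n f \<le> \<bar>1 / c\<bar> * ?n (c *\<^sub>R f)"
      using le[OF scale[OF that], of "1 / c" c] False by simp
    then have "\<bar>c\<bar> * ?n f \<le> ?n (c *\<^sub>R f)"
      using False by (simp add: field_simps)
    with le[OF that, of c] show ?thesis by simp
  qed (use norm0 in simp)
  have triangle: "?n (f + g) \<le> ?n f + ?n g" if "f \<in> ?D" "g \<in> ?D" for f g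
    using upper[OF that(1)] upper[OF that(2)]
    by (intro least) (auto intro!: order_trans[OF abs_triangle_ineq] add_mono)
  show ?thesis
    using norm0 definite
    by (auto simp: normed_space_on_def subspace_def zeroD add scale nonneg homogeneous triangle)
qed

definition BCP_on :: "'a::real_vector set \<Rightarrow> ('a \<Rightarrow> real) \<Rightarrow> bool" where
  "BCP_on Z N \<longleftrightarrow>
     (\<exists>B :: ('a \<times> real) set. countable B \<and>
        (\<forall>(z, r)\<in>B. z \<in> Z \<and> 0 < r \<and> r \<le> N z) \<and>
        {x \<in> Z. N x = 1} \<subseteq> (\<Union>(z, r)\<in>B. Metric_space.mball Z (ndist Z N) z r))"

end

theory Submission
  imports Defs
begin

text \<open>
  On the binary tree \<open>T\<close>, let \<open>F\<close> be the set of finitely supported functions with values in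
  \<open>{-1, 0, 1}\<close> which take opposite signs at any two comparable nodes of their support, and let
  \<open>X\<close> be the completion of the finitely supported functions on \<open>T\<close> under the norm whose dual norm is
  \<open>\<parallel>z\<parallel> = sup {f(z) | f \<in> F}\<close>.  Every \<open>f \<in> F\<close> is a difference of indicators of two antichains, and
  \<open>F\<close> contains all signed antichains, so this norm lies between a lattice norm and twice that
  norm, and the unit vectors are a \<open>2\<close>-unconditional basis.

  The sum along a branch \<open>\<beta>\<close> is a functional \<open>x\<close> of norm one.  Since the dual norm dominates the
  \<open>\<ell>\<^sub>1\<close>-norm on antichains, every \<open>z\<close> in the dual tends to zero along all but countably many
  branches, so for countably many centres one may choose \<open>\<beta>\<close> such that all of them tend to zero
  along \<open>\<beta>\<close>.  Then \<open>\<parallel>z - x\<parallel> \<ge> \<parallel>z\<parallel>\<close> for each centre \<open>z\<close>: if \<open>f(x) \<le> 0\<close> then \<open>f(z - x) \<ge> f(z)\<close>, and if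
  \<open>f(x) = 1\<close> then for nodes \<open>k\<close> far out on \<open>\<beta>\<close> also \<open>f - e\<^sub>k \<in> F\<close>, which is \<open>0\<close> at \<open>x\<close> and nearly \<open>f(z)\<close> at \<open>z\<close>.
  Hence no ball \<open>B(z, r)\<close> with \<open>r \<le> \<parallel>z\<parallel>\<close> contains \<open>x\<close>.
\<close>

section \<open>The binary tree\<close>

text \<open>The nodes are the natural numbers: the parent of \<open>t\<close> is \<open>t div 2\<close>, and \<open>0\<close> is an extra root
  below the usual root \<open>1\<close>.\<close>

definition below :: "nat \<Rightarrow> nat \<Rightarrow> bool"
  where "below s t \<longleftrightarrow> (\<exists>j. s = t div 2 ^ j)"

definition comparable :: "nat \<Rightarrow> nat \<Rightarrow> bool"
  where "comparable s t \<longleftrightarrow> below s t \<or> below t s"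

lemma below_le: "below s t \<Longrightarrow> s \<le> t"
  by (auto simp: below_def)

text \<open>Level \<open>n\<close> consists of the numbers with \<open>n + 1\<close> binary digits;
  \<open>b\<close> supplies the digits after the leading 1, and halving deletes the last
  one.\<close>

fun node :: "(nat \<Rightarrow> bool) \<Rightarrow> nat \<Rightarrow> nat" where
  "node b 0 = 1"
| "node b (Suc n) = 2 * node b n + of_bool (b n)"

definition branch :: "(nat \<Rightarrow> bool) \<Rightarrow> nat set"
  where "branch b = insert 0 (range (node b))"

lemma node_div: "node b (n + j) div 2 ^ j = node b n"
proof (induction j)
  case (Suc j)
  have "node b (n + Suc j) div 2 ^ Suc j = node b (n + Suc j) div 2 div 2 ^ j"
    by (simp add: div_mult2_eq)
  also have "node b (n + Suc j) div 2 = node b (n + j)"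
    by simp
  finally show ?case using Suc by simp
qed simp

lemma node_bounds: "2 ^ n \<le> node b n \<and> node b n < 2 ^ Suc n"
  by (induction n) auto

lemma node_level: "node b m = node c n \<Longrightarrow> m = n"
proof (rule ccontr)
  assume eq: "node b m = node c n" and "m \<noteq> n"
  then consider "Suc m \<le> n" | "Suc n \<le> m" by linarith
  then show False
  proof cases
    case 1
    then have "(2::nat) ^ Suc m \<le> 2 ^ n" by (intro power_increasing) auto
    with node_bounds[of m b] node_bounds[of n c] eq show False by linarith
  next
    case 2
    then have "(2::nat) ^ Suc n \<le> 2 ^ m" by (intro power_increasing) auto
    with node_bounds[of m b] node_bounds[of n c] eq show False by linarith
  qed
qed

lemma branch_down_closed:
  assumes "t \<in> branch b" "below s t"
  shows "s \<in> branch b"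
proof -
  obtain j where j: "s = t div 2 ^ j" using assms(2) by (auto simp: below_def)
  consider "t = 0" | n where "t = node b n" using assms(1) by (auto simp: branch_def)
  then show ?thesis
  proof cases
    case 1
    then show ?thesis using j by (simp add: branch_def)
  next
    case 2
    show ?thesis
    proof (cases "j \<le> n")
      case True
      then have "s = node b (n - j)" using node_div[of b "n - j" j] j 2 by simp
      then show ?thesis by (simp add: branch_def)
    next
      \<comment> \<open>Halving past the usual root 1 ends at the extra root 0, which every branch
        contains.\<close>
      case False
      then have "(2::nat) ^ Suc n \<le> 2 ^ j" by (intro power_increasing) auto
      then have "s = 0" using node_bounds[of n b] j 2 by simp
      then show ?thesis by (simp add: branch_def)
    qed
  qed
qed

lemma branch_chain:
  assumes "s \<in> branch b" "t \<in> branch b"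
  shows "comparable s t"
proof -
  have zero: "below 0 u" for u :: nat
  proof -
    have "u < 2 ^ u" by simp
    then have "0 = u div 2 ^ u" by simp
    then show ?thesis unfolding below_def by blast
  qed
  have le: "below (node b m) (node b n)" if "m \<le> n" for m n
    using node_div[of b m "n - m"] that unfolding below_def
    by (metis le_add_diff_inverse)
  show ?thesis
    using assms zero le by (auto simp: branch_def comparable_def) (metis linear)
qed

lemma infinite_branch: "infinite (branch b)"
proof -
  have "inj (node b)" by (auto intro: injI node_level)
  then have "infinite (range (node b))" by (rule range_inj_infinite)
  then show ?thesis by (simp add: branch_def)
qed

text \<open>A digit in which \<open>b\<close> and \<open>c\<close> differ stays visible in all
  deeper nodes, so common nodes lie on levels up to \<open>i\<close>.\<close>

lemma branch_almost_disjoint: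
  assumes "b \<noteq> c"
  shows "finite (branch b \<inter> branch c)"
proof -
  obtain i where i: "b i \<noteq> c i" using assms by blast
  have "branch b \<inter> branch c \<subseteq> insert 0 (node b ` {..i})"
  proof
    fix t assume t: "t \<in> branch b \<inter> branch c"
    show "t \<in> insert 0 (node b ` {..i})"
    proof (cases "t = 0")
      case False
      obtain n m where "t = node b n" "t = node c m"
        using t False unfolding branch_def by blast
      then have n: "t = node b n" "t = node c n"
        using node_level[of b n c m] by auto
      have "n \<le> i"
      proof (rule ccontr)
        assume "\<not> n \<le> i"
        then have "node b n div 2 ^ (n - Suc i) = node b (Suc i)"
          and "node c n div 2 ^ (n - Suc i) = node c (Suc i)"
          using node_div[of _ "Suc i" "n - Suc i"] by (simp_all del: node.simps)
        with n have "node b (Suc i) = node c (Suc i)" by metis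
        then have "2 * node b i + of_bool (b i) = 2 * node c i + of_bool (c i)"
          by simp
        \<comment> \<open>The last binary digit of the node on level \<open>Suc i\<close> is
          \<open>b i\<close>, so parity separates the two branches.\<close>
        then have "even (2 * node b i + of_bool (b i)) = even (2 * node c i + of_bool (c i))"
          by (rule arg_cong)
        then show False
          using i by (auto split: if_splits)
      qed
      then show ?thesis using n by simp
    qed simp
  qed
  then show ?thesis by (rule finite_subset) simp
qed

text \<open>Cantor's diagonal argument. Branches are indexed by this space, which leaves room to
  avoid countably many of them.\<close>

lemma uncountable_cantor_space: "uncountable (UNIV :: (nat \<Rightarrow> bool) set)"
proof
  assume "countable (UNIV :: (nat \<Rightarrow> bool) set)"
  then obtain g :: "nat \<Rightarrow> nat \<Rightarrow> bool" where g: "range g = UNIV"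
    by (metis UNIV_not_empty range_from_nat_into)
  have "(\<lambda>n. \<not> g n n) \<in> range g" using g by simp
  then obtain m where "(\<lambda>n. \<not> g n n) = g m" by blast
  then show False by (metis (full_types))
qed

section \<open>The norming functions\<close>

text \<open>The set \<open>F\<close> of the introduction. For values in -1, 0, 1, a nonpositive
  product means opposite signs or a zero.\<close>

definition alternating :: "(nat \<Rightarrow> real) set" where
  "alternating = {f. finite {t. f t \<noteq> 0} \<and> (\<forall>t. f t \<in> {-1, 0, 1}) \<and>
     (\<forall>s t. s \<noteq> t \<longrightarrow> comparable s t \<longrightarrow> f s * f t \<le> 0)}"

definition unit :: "nat \<Rightarrow> nat \<Rightarrow> real"
  where "unit k = (\<lambda>t. if t = k then 1 else 0)"

definition restr :: "nat set \<Rightarrow> (nat \<Rightarrow> real) \<Rightarrow> nat \<Rightarrow> real"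
  where "restr A z = (\<lambda>t. if t \<in> A then z t else 0)"

text \<open>Summing over the support of the second argument alone makes the first argument
  arbitrary: linearity in \<open>a\<close> is unconditional, while rules about \<open>z\<close>
  require finite support.\<close>

definition pairing :: "(nat \<Rightarrow> real) \<Rightarrow> (nat \<Rightarrow> real) \<Rightarrow> real"
  where "pairing a z = (\<Sum>t | z t \<noteq> 0. a t * z t)"

lemma alternating_finite: "f \<in> alternating \<Longrightarrow> finite {t. f t \<noteq> 0}"
  and alternating_values: "f \<in> alternating \<Longrightarrow> f t \<in> {-1, 0, 1}"
  and alternating_mult: "f \<in> alternating \<Longrightarrow> s \<noteq> t \<Longrightarrow> comparable s t \<Longrightarrow> f s * f t \<le> 0"
  by (simp_all add: alternating_def)

lemma alternating_restr: "f \<in> alternating \<Longrightarrow> restr A f \<in> alternating"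
  unfolding alternating_def restr_def by (auto elim: rev_finite_subset)

lemma alternating_uminus: "f \<in> alternating \<Longrightarrow> - f \<in> alternating"
  unfolding alternating_def by (auto simp: minus_equation_iff) metis

lemma alternating_unit: "unit k \<in> alternating"
  by (auto simp: alternating_def unit_def)

lemma alternating_zero: "0 \<in> alternating"
  by (auto simp: alternating_def)

text \<open>Distinct comparable nodes cannot both lie in \<open>A\<close>, so the sign condition is
  vacuous.\<close>

lemma alternating_antichain:
  assumes "finite A" "\<And>s t. s \<in> A \<Longrightarrow> t \<in> A \<Longrightarrow> comparable s t \<Longrightarrow> s = t"
    and "\<And>t. t \<in> A \<Longrightarrow> g t \<in> {-1, 0, 1}"
  shows "restr A g \<in> alternating"
  using assms unfolding alternating_def restr_def by (auto elim: rev_finite_subset)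

text \<open>Two positive values on a chain would have a positive product, so at most one node
  carries 1 and all others contribute at most 0. A node with value -1 cancels that single 1.\<close>

lemma chain_sum_le:
  assumes f: "f \<in> alternating" and "finite C"
    and chain: "\<And>s t. s \<in> C \<Longrightarrow> t \<in> C \<Longrightarrow> comparable s t"
  shows "sum f C \<le> 1"
    and "s \<in> C \<Longrightarrow> f s < 0 \<Longrightarrow> sum f C \<le> 0"
proof -
  let ?P = "{t \<in> C. f t > 0}"
  have "s = t" if "s \<in> ?P" "t \<in> ?P" for s t
  proof (rule ccontr)
    assume "s \<noteq> t"
    then have "f s * f t \<le> 0" using that chain alternating_mult[OF f] by blast
    moreover have "f s * f t > 0" using that by simp
    ultimately show False by linarith
  qed
  then have "card ?P \<le> 1"
    using \<open>finite C\<close> by (simp add: card_le_Suc0_iff_eq)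
  moreover have "sum f ?P \<le> of_nat (card ?P) * 1"
    by (rule sum_bounded_above) (metis (lifting) alternating_values[OF f] insertE mem_Collect_eq less_eq_real_def neg_le_0_iff_le singletonD zero_le_one order_trans)
  ultimately have P: "sum f ?P \<le> 1" by simp
  have split: "sum f C = sum f ?P + sum f (C - ?P)"
    using \<open>finite C\<close> by (metis (no_types, lifting) add.commute mem_Collect_eq subsetI sum.subset_diff)
  have nonpos: "sum f (C - ?P) \<le> 0" by (rule sum_nonpos) auto
  show "sum f C \<le> 1" using P split nonpos by linarith
  show "sum f C \<le> 0" if "s \<in> C" "f s < 0"
  proof -
    have "sum f (C - ?P) = f s + sum f (C - ?P - {s})"
      using that \<open>finite C\<close> by (intro sum.remove) auto
    moreover have "sum f (C - ?P - {s}) \<le> 0" by (rule sum_nonpos) auto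
    moreover have "f s = -1" using that alternating_values[OF f, of s] by auto
    ultimately show ?thesis using P split by linarith
  qed
qed

section \<open>Rules for the pairing with finitely supported functions\<close>

lemma pairing_superset:
  assumes "finite S" "{t. z t \<noteq> 0} \<subseteq> S"
  shows "pairing a z = (\<Sum>t\<in>S. a t * z t)"
  unfolding pairing_def using assms by (intro sum.mono_neutral_left) auto

lemma pairing_add: "pairing (a + b) z = pairing a z + pairing b z"
  by (simp add: pairing_def distrib_right sum.distrib)

lemma pairing_diff: "pairing (a - b) z = pairing a z - pairing b z"
  by (simp add: pairing_def left_diff_distrib sum_subtractf)

lemma pairing_scaleR: "pairing (c *\<^sub>R a) z = c * pairing a z"
  by (simp add: pairing_def scaleR_fun_def sum_distrib_left mult.assoc)

lemma pairing_scaleR_right: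
  assumes "finite {t. z t \<noteq> 0}"
  shows "pairing a (c *\<^sub>R z) = c * pairing a z"
proof -
  have "pairing a (c *\<^sub>R z) = (\<Sum>t | z t \<noteq> 0. a t * (c *\<^sub>R z) t)"
    using assms by (intro pairing_superset) (auto simp: scaleR_fun_def)
  then show ?thesis
    by (simp add: pairing_def scaleR_fun_def sum_distrib_left mult_ac)
qed

lemma pairing_restr:
  assumes "finite {t. z t \<noteq> 0}"
  shows "pairing a (restr A z) = pairing (restr A a) z"
proof -
  have "pairing a (restr A z) = (\<Sum>t | z t \<noteq> 0. a t * restr A z t)"
    using assms by (intro pairing_superset) (auto simp: restr_def)
  also have "\<dots> = pairing (restr A a) z"
    unfolding pairing_def by (intro sum.cong) (auto simp: restr_def)
  finally show ?thesis .
qed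

lemma pairing_unit [simp]: "pairing a (unit k) = a k"
  by (simp add: pairing_def unit_def)

lemma pairing_unit_left: "finite {t. z t \<noteq> 0} \<Longrightarrow> pairing (unit k) z = z k"
  by (cases "z k = 0") (auto simp: pairing_def unit_def if_distrib[of "\<lambda>x. x * _"] cong: if_cong)

lemma pairing_commute:
  assumes "finite {t. a t \<noteq> 0}" "finite {t. z t \<noteq> 0}"
  shows "pairing a z = pairing z a"
proof -
  let ?S = "{t. a t \<noteq> 0} \<union> {t. z t \<noteq> 0}"
  have "pairing a z = (\<Sum>t\<in>?S. a t * z t)" and "pairing z a = (\<Sum>t\<in>?S. z t * a t)"
    using assms by (auto intro!: pairing_superset)
  then show ?thesis by (simp add: mult.commute)
qed

text \<open>The polar of \<open>F\<close> among finitely supported functions. By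
  \<open>dual_norm_ge\<close> and \<open>dual_norm_le\<close> these turn out to be the finitely
  supported elements of the dual unit ball.\<close>

definition polar :: "(nat \<Rightarrow> real) set"
  where "polar = {z. finite {t. z t \<noteq> 0} \<and> (\<forall>f\<in>alternating. \<bar>pairing f z\<bar> \<le> 1)}"

lemma polar_finite: "z \<in> polar \<Longrightarrow> finite {t. z t \<noteq> 0}"
  by (simp add: polar_def)

lemma polar_bound: "z \<in> polar \<Longrightarrow> f \<in> alternating \<Longrightarrow> \<bar>pairing f z\<bar> \<le> 1"
  by (simp add: polar_def)

lemma zero_polar: "0 \<in> polar"
  by (simp add: polar_def pairing_def)

lemma restr_polar:
  assumes "z \<in> polar"
  shows "restr A z \<in> polar"
proof -
  have fin: "finite {t. restr A z t \<noteq> 0}"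
    using polar_finite[OF assms] by (rule rev_finite_subset) (auto simp: restr_def)
  have "\<bar>pairing f (restr A z)\<bar> \<le> 1" if "f \<in> alternating" for f
    using polar_bound[OF assms alternating_restr[OF that]] polar_finite[OF assms]
    by (simp add: pairing_restr)
  with fin show ?thesis by (simp add: polar_def)
qed

lemma unit_polar: "unit k \<in> polar"
proof -
  have "\<bar>f k\<bar> \<le> 1" if "f \<in> alternating" for f
    using alternating_values[OF that, of k] by auto
  then show ?thesis by (simp add: polar_def) (simp add: unit_def)
qed

lemma polar_abs_le_1:
  assumes "z \<in> polar"
  shows "\<bar>z t\<bar> \<le> 1"
  using polar_bound[OF assms alternating_unit[of t]] polar_finite[OF assms]
  by (simp add: pairing_unit_left)

text \<open>Pairing with the indicator of a chain is summation along it, so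
  \<open>chain_sum_le\<close> for \<open>f\<close> and \<open>- f\<close> gives the bound. These
  indicators are the partial sums of the branch functionals.\<close>

lemma chain_polar:
  assumes "finite C" "\<And>s t. s \<in> C \<Longrightarrow> t \<in> C \<Longrightarrow> comparable s t"
  shows "restr C (\<lambda>_. 1) \<in> polar"
proof -
  have "pairing f (restr C (\<lambda>_. 1)) = sum f C" for f
  proof -
    have "pairing f (restr C (\<lambda>_. 1)) = (\<Sum>t\<in>C. f t * restr C (\<lambda>_. 1) t)"
      using assms(1) by (intro pairing_superset) (auto simp: restr_def)
    then show ?thesis by (simp add: restr_def)
  qed
  moreover have "\<bar>sum f C\<bar> \<le> 1" if "f \<in> alternating" for f
    using chain_sum_le(1)[OF that assms] chain_sum_le(1)[OF alternating_uminus[OF that] assms]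
    by (simp add: sum_negf)
  moreover have "finite {t. restr C (\<lambda>_. 1) t \<noteq> (0::real)}"
    using assms(1) by (rule rev_finite_subset) (auto simp: restr_def)
  ultimately show ?thesis by (simp add: polar_def)
qed

text \<open>Two comparable nodes in the support of \<open>f\<close> carry opposite signs, so the sets where \<open>f = 1\<close> and
  where \<open>f = -1\<close> are antichains, and signs on an antichain are arbitrary.\<close>

lemma half_sign_change_polar:
  assumes z: "z \<in> polar" and w: "\<And>t. \<bar>w t\<bar> \<le> \<bar>z t\<bar>"
  shows "(1/2) *\<^sub>R w \<in> polar"
proof -
  have finz: "finite {t. z t \<noteq> 0}" by (rule polar_finite[OF z])
  have finw: "finite {t. w t \<noteq> 0}"
  proof (rule rev_finite_subset[OF finz], rule subsetI)
    fix t assume "t \<in> {t. w t \<noteq> 0}"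
    with w[of t] show "t \<in> {t. z t \<noteq> 0}" by auto
  qed
  \<comment> \<open>On an antichain the signs of \<open>z\<close> themselves form an element of
    \<open>F\<close>; pairing \<open>z\<close> with it gives the \<ell>1-norm there.\<close>
  have half: "(\<Sum>t\<in>A. \<bar>z t\<bar>) \<le> 1"
    if "finite A" "\<And>s t. s \<in> A \<Longrightarrow> t \<in> A \<Longrightarrow> comparable s t \<Longrightarrow> s = t" for A
  proof -
    let ?g = "restr A (\<lambda>t. sgn (z t))"
    have g: "?g \<in> alternating"
      using that by (intro alternating_antichain) (auto simp: sgn_real_def)
    have "pairing ?g z = pairing z ?g"
      using alternating_finite[OF g] finz by (rule pairing_commute)
    also have "\<dots> = (\<Sum>t\<in>A. z t * ?g t)"
      using that(1) by (intro pairing_superset) (auto simp: restr_def)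
    also have "\<dots> = (\<Sum>t\<in>A. \<bar>z t\<bar>)"
      by (intro sum.cong) (auto simp: restr_def abs_sgn)
    finally show ?thesis using polar_bound[OF z g] by linarith
  qed
  have "\<bar>pairing f w\<bar> \<le> 2" if f: "f \<in> alternating" for f
  proof -
    let ?P = "{t. f t = 1}" and ?Q = "{t. f t = -1}"
    have fin: "finite ?P" "finite ?Q"
      using alternating_finite[OF f] by (auto elim!: rev_finite_subset)
    have "pairing f w = pairing w f"
      using finw alternating_finite[OF f] by (intro pairing_commute)
    also have "\<dots> = (\<Sum>t\<in>?P \<union> ?Q. w t * f t)"
      using fin alternating_values[OF f] by (intro pairing_superset) auto
    finally have "\<bar>pairing f w\<bar> \<le> (\<Sum>t\<in>?P \<union> ?Q. \<bar>w t * f t\<bar>)"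
      by (metis sum_abs)
    also have "\<dots> \<le> (\<Sum>t\<in>?P \<union> ?Q. \<bar>z t\<bar>)"
      using w by (intro sum_mono) auto
    also have "\<dots> = (\<Sum>t\<in>?P. \<bar>z t\<bar>) + (\<Sum>t\<in>?Q. \<bar>z t\<bar>)"
      using fin by (intro sum.union_disjoint) auto
    \<comment> \<open>Each of the two antichains contributes at most 1: this is the origin of the
      constant 2.\<close>
    also have "\<dots> \<le> 1 + 1"
    proof (intro add_mono half fin)
      show "s = t" if "s \<in> ?P" "t \<in> ?P" "comparable s t" for s t
        using alternating_mult[OF f, of s t] that by auto
      show "s = t" if "s \<in> ?Q" "t \<in> ?Q" "comparable s t" for s t
        using alternating_mult[OF f, of s t] that by auto
    qed
    finally show ?thesis by simp
  qed
  moreover have "finite {t. ((1/2) *\<^sub>R w) t \<noteq> 0}"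
    using finw by (simp add: scaleR_fun_def)
  ultimately show ?thesis
    using finw by (auto simp: polar_def pairing_scaleR_right simp del: scaleR_half_double)
qed

section \<open>The space\<close>

text \<open>Testing only against finitely supported \<open>z\<close> keeps every pairing a finite
  sum. The supremum is finite on \<open>tree_space\<close> by \<open>tree_norm_bdd\<close>.\<close>

definition tree_norm :: "(nat \<Rightarrow> real) \<Rightarrow> real"
  where "tree_norm a = (SUP z\<in>polar. \<bar>pairing a z\<bar>)"

text \<open>The completion of the finitely supported functions under \<^term>\<open>tree_norm\<close>, realised as the
  functions whose tails have arbitrarily small norm.\<close>

definition tree_space :: "(nat \<Rightarrow> real) set" where
  "tree_space = {a. \<forall>\<epsilon>>0. \<exists>n. \<forall>z\<in>polar. (\<forall>t<n. z t = 0) \<longrightarrow> \<bar>pairing a z\<bar> \<le> \<epsilon>}"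

lemma tree_spaceI:
  assumes "\<And>\<epsilon>. 0 < \<epsilon> \<Longrightarrow> \<exists>n. \<forall>z\<in>polar. (\<forall>t<n. z t = 0) \<longrightarrow> \<bar>pairing a z\<bar> \<le> \<epsilon>"
  shows "a \<in> tree_space"
  using assms by (simp add: tree_space_def)

lemma tree_spaceE:
  assumes "a \<in> tree_space" "0 < \<epsilon>"
  obtains n where "\<And>z. z \<in> polar \<Longrightarrow> \<forall>t<n. z t = 0 \<Longrightarrow> \<bar>pairing a z\<bar> \<le> \<epsilon>"
  using assms unfolding tree_space_def by blast

lemma restr_split: "restr {..<n} a + restr {n..} a = a"
  by (auto simp: restr_def fun_eq_iff)

lemma pairing_tail:
  "z \<in> polar \<Longrightarrow> pairing (restr {n..} a) z = pairing a (restr {n..} z)"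
  by (simp add: pairing_restr polar_finite)

text \<open>Cut \<open>a\<close> at an \<open>n\<close> whose tail is bounded by 1; the head is
  bounded by its \<ell>1-norm, because polar elements have entries of modulus at most 1.\<close>

lemma tree_norm_bdd:
  assumes "a \<in> tree_space"
  shows "bdd_above ((\<lambda>z. \<bar>pairing a z\<bar>) ` polar)"
proof -
  obtain n where n: "\<And>z. z \<in> polar \<Longrightarrow> \<forall>t<n. z t = 0 \<Longrightarrow> \<bar>pairing a z\<bar> \<le> 1"
    using tree_spaceE[OF assms, of 1] by auto
  have "\<bar>pairing a z\<bar> \<le> (\<Sum>t<n. \<bar>a t\<bar>) + 1" if z: "z \<in> polar" for z
  proof -
    have "pairing a z = pairing (restr {..<n} a) z + pairing (restr {n..} a) z"
      by (metis pairing_add restr_split)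
    moreover have "\<bar>pairing (restr {n..} a) z\<bar> \<le> 1"
      using z n[OF restr_polar[OF z, of "{n..}"]] by (simp add: pairing_tail) (simp add: restr_def)
    moreover have "\<bar>pairing (restr {..<n} a) z\<bar> \<le> (\<Sum>t<n. \<bar>a t\<bar>)"
    proof -
      have "pairing (restr {..<n} a) z = pairing a (restr {..<n} z)"
        using z by (simp add: pairing_restr polar_finite)
      also have "\<dots> = (\<Sum>t<n. a t * restr {..<n} z t)"
        by (intro pairing_superset) (auto simp: restr_def)
      also have "\<bar>\<dots>\<bar> \<le> (\<Sum>t<n. \<bar>a t * restr {..<n} z t\<bar>)"
        by (rule sum_abs)
      also have "\<dots> \<le> (\<Sum>t<n. \<bar>a t\<bar>)"
        using polar_abs_le_1[OF restr_polar[OF z]]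
        by (intro sum_mono) (simp add: abs_mult mult_left_le)
      finally show ?thesis .
    qed
    ultimately show ?thesis by linarith
  qed
  then show ?thesis by (intro bdd_aboveI) auto
qed

lemma pairing_le_tree_norm:
  "a \<in> tree_space \<Longrightarrow> z \<in> polar \<Longrightarrow> \<bar>pairing a z\<bar> \<le> tree_norm a"
  unfolding tree_norm_def by (intro cSUP_upper tree_norm_bdd)

lemma tree_norm_le:
  "(\<And>z. z \<in> polar \<Longrightarrow> \<bar>pairing a z\<bar> \<le> c) \<Longrightarrow> tree_norm a \<le> c"
  unfolding tree_norm_def using zero_polar by (intro cSUP_least) auto

text \<open>Continuity of the coordinates yields definiteness of the norm, pointwise limits of
  Cauchy sequences and uniqueness of basis expansions.\<close>

lemma abs_coord_le: "a \<in> tree_space \<Longrightarrow> \<bar>a t\<bar> \<le> tree_norm a"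
  using pairing_le_tree_norm[OF _ unit_polar] by simp

section \<open>Linear structure, norm and completeness\<close>

lemma tree_space_zero: "0 \<in> tree_space"
  by (simp add: tree_space_def pairing_def)

lemma tree_space_add:
  assumes "a \<in> tree_space" "b \<in> tree_space"
  shows "a + b \<in> tree_space"
proof (rule tree_spaceI)
  fix \<epsilon> :: real assume "0 < \<epsilon>"
  then have "0 < \<epsilon> / 2" by simp
  obtain m where m: "\<And>z. z \<in> polar \<Longrightarrow> \<forall>t<m. z t = 0 \<Longrightarrow> \<bar>pairing a z\<bar> \<le> \<epsilon> / 2"
    using tree_spaceE[OF assms(1) \<open>0 < \<epsilon> / 2\<close>] by blast
  obtain n where n: "\<And>z. z \<in> polar \<Longrightarrow> \<forall>t<n. z t = 0 \<Longrightarrow> \<bar>pairing b z\<bar> \<le> \<epsilon> / 2"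
    using tree_spaceE[OF assms(2) \<open>0 < \<epsilon> / 2\<close>] by blast
  have "\<bar>pairing (a + b) z\<bar> \<le> \<epsilon>" if "z \<in> polar" "\<forall>t<max m n. z t = 0" for z
    using m[of z] n[of z] that by (simp add: pairing_add)
  then show "\<exists>n. \<forall>z\<in>polar. (\<forall>t<n. z t = 0) \<longrightarrow> \<bar>pairing (a + b) z\<bar> \<le> \<epsilon>"
    by blast
qed

lemma tree_space_scaleR:
  assumes "a \<in> tree_space"
  shows "c *\<^sub>R a \<in> tree_space"
proof (rule tree_spaceI)
  fix \<epsilon> :: real assume "0 < \<epsilon>"
  \<comment> \<open>Adding 1 keeps the divisor positive when \<open>c = 0\<close>.\<close>
  then have "0 < \<epsilon> / (\<bar>c\<bar> + 1)" by simp
  then obtain n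
    where n: "\<And>z. z \<in> polar \<Longrightarrow> \<forall>t<n. z t = 0 \<Longrightarrow> \<bar>pairing a z\<bar> \<le> \<epsilon> / (\<bar>c\<bar> + 1)"
    using tree_spaceE[OF assms] by blast
  have "\<bar>pairing (c *\<^sub>R a) z\<bar> \<le> \<epsilon>" if "z \<in> polar" "\<forall>t<n. z t = 0" for z
  proof -
    have "\<bar>pairing (c *\<^sub>R a) z\<bar> \<le> (\<bar>c\<bar> + 1) * \<bar>pairing a z\<bar>"
      by (simp add: pairing_scaleR abs_mult distrib_right)
    also have "\<dots> \<le> (\<bar>c\<bar> + 1) * (\<epsilon> / (\<bar>c\<bar> + 1))"
      using n[OF that] by (intro mult_left_mono) auto
    finally show ?thesis by (simp add: add_nonneg_eq_0_iff)
  qed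
  then show "\<exists>n. \<forall>z\<in>polar. (\<forall>t<n. z t = 0) \<longrightarrow> \<bar>pairing (c *\<^sub>R a) z\<bar> \<le> \<epsilon>"
    by blast
qed

lemma subspace_tree_space: "subspace tree_space"
  by (simp add: subspace_def tree_space_zero tree_space_add tree_space_scaleR)

lemma finite_support_tree_space:
  assumes "finite {t. a t \<noteq> 0}"
  shows "a \<in> tree_space"
proof (rule tree_spaceI)
  fix \<epsilon> :: real assume "0 < \<epsilon>"
  obtain n where n: "{t. a t \<noteq> 0} \<subseteq> {..<n}"
    using assms finite_nat_iff_bounded by blast
  have "pairing a z = 0" if "\<forall>t<n. z t = 0" for z
    unfolding pairing_def using n that by (intro sum.neutral) force
  with \<open>0 < \<epsilon>\<close> show "\<exists>n. \<forall>z\<in>polar. (\<forall>t<n. z t = 0) \<longrightarrow> \<bar>pairing a z\<bar> \<le> \<epsilon>"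
    by (metis abs_zero less_imp_le)
qed

lemma unit_tree_space: "unit k \<in> tree_space"
  by (rule finite_support_tree_space) (simp add: unit_def)

lemma restr_tree_space: "finite A \<Longrightarrow> restr A a \<in> tree_space"
  by (rule finite_support_tree_space, erule rev_finite_subset) (auto simp: restr_def)

lemma alternating_tree_space: "f \<in> alternating \<Longrightarrow> f \<in> tree_space"
  by (intro finite_support_tree_space alternating_finite)

lemma tree_norm_alternating: "f \<in> alternating \<Longrightarrow> tree_norm f \<le> 1"
  by (intro tree_norm_le polar_bound)

lemma normed_tree_space: "normed_space_on tree_space tree_norm"
proof -
  have nonneg: "0 \<le> tree_norm a" if "a \<in> tree_space" for a
    using abs_coord_le[OF that, of 0] by linarith
  have zero: "tree_norm 0 = 0"
    using nonneg[OF tree_space_zero] tree_norm_le[of 0 0] by (simp add: pairing_def)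
  have definite: "a = 0" if "a \<in> tree_space" "tree_norm a = 0" for a
    using abs_coord_le[OF that(1)] that(2) by (auto simp: fun_eq_iff)
  have le: "tree_norm (c *\<^sub>R a) \<le> \<bar>c\<bar> * tree_norm a" if "a \<in> tree_space" for a c
    using pairing_le_tree_norm[OF that]
    by (intro tree_norm_le) (simp add: pairing_scaleR abs_mult mult_left_mono)
  have homogeneous: "tree_norm (c *\<^sub>R a) = \<bar>c\<bar> * tree_norm a" if "a \<in> tree_space" for a c
  proof (cases "c = 0")
    case False
    have "tree_norm a \<le> \<bar>1 / c\<bar> * tree_norm (c *\<^sub>R a)"
      using le[OF tree_space_scaleR[OF that], of "1 / c" c] False by simp
    then have "\<bar>c\<bar> * tree_norm a \<le> tree_norm (c *\<^sub>R a)"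
      using False by (simp add: field_simps)
    with le[OF that, of c] show ?thesis by simp
  qed (use zero in simp)
  have triangle: "tree_norm (a + b) \<le> tree_norm a + tree_norm b"
    if "a \<in> tree_space" "b \<in> tree_space" for a b
    using pairing_le_tree_norm[OF that(1)] pairing_le_tree_norm[OF that(2)]
    by (intro tree_norm_le) (auto simp: pairing_add intro!: order_trans[OF abs_triangle_ineq] add_mono)
  show ?thesis
    using zero definite
    by (auto simp: normed_space_on_def subspace_tree_space nonneg homogeneous triangle)
qed

lemma tree_norm_nonneg: "a \<in> tree_space \<Longrightarrow> 0 \<le> tree_norm a"
  using normed_tree_space by (simp add: normed_space_on_def)

lemma tree_space_diff: "a \<in> tree_space \<Longrightarrow> b \<in> tree_space \<Longrightarrow> a - b \<in> tree_space"
  by (rule subspace_diff[OF subspace_tree_space])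

text \<open>Cauchy sequences converge coordinatewise, and each pairing is a finite sum, so the
  Cauchy estimate passes to the pointwise limit uniformly over \<open>polar\<close>.\<close>

lemma banach_tree_space: "banach_space_on tree_space tree_norm"
proof -
  interpret Metric_space tree_space "ndist tree_space tree_norm"
    by (rule Metric_space_ndist[OF normed_tree_space])
  have "\<exists>l. limitin mtopology \<sigma> l sequentially" if "MCauchy \<sigma>" for \<sigma>
  proof -
    have in_space: "\<sigma> n \<in> tree_space" for n
      using that unfolding MCauchy_def by blast
    have cauchy: "\<exists>M. \<forall>m\<ge>M. \<forall>n\<ge>M. tree_norm (\<sigma> m - \<sigma> n) < \<epsilon>" if \<epsilon>: "0 < \<epsilon>" for \<epsilon>
    proof -
      obtain M where "\<forall>m n. M \<le> m \<longrightarrow> M \<le> n \<longrightarrow> ndist tree_space tree_norm (\<sigma> m) (\<sigma> n) < \<epsilon>"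
        using \<open>MCauchy \<sigma>\<close> \<epsilon> unfolding MCauchy_def by blast
      then show ?thesis using in_space by (auto simp: ndist_def)
    qed
    have "Cauchy (\<lambda>n. \<sigma> n t)" for t
    proof (rule metric_CauchyI)
      fix \<epsilon> :: real assume "0 < \<epsilon>"
      then obtain M where M: "\<forall>m\<ge>M. \<forall>n\<ge>M. tree_norm (\<sigma> m - \<sigma> n) < \<epsilon>"
        using cauchy by blast
      have "dist (\<sigma> m t) (\<sigma> n t) < \<epsilon>" if "m \<ge> M" "n \<ge> M" for m n
      proof -
        have "\<bar>(\<sigma> m - \<sigma> n) t\<bar> \<le> tree_norm (\<sigma> m - \<sigma> n)"
          by (intro abs_coord_le tree_space_diff in_space)
        moreover have "tree_norm (\<sigma> m - \<sigma> n) < \<epsilon>" using M that by blast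
        ultimately show ?thesis by (simp add: dist_real_def)
      qed
      then show "\<exists>M. \<forall>m\<ge>M. \<forall>n\<ge>M. dist (\<sigma> m t) (\<sigma> n t) < \<epsilon>" by blast
    qed
    define l where "l = (\<lambda>t. lim (\<lambda>n. \<sigma> n t))"
    have l: "(\<lambda>n. \<sigma> n t) \<longlonglongrightarrow> l t" for t
      using \<open>\<And>t. Cauchy (\<lambda>n. \<sigma> n t)\<close> by (simp add: l_def Cauchy_convergent_iff convergent_LIMSEQ_iff)
    \<comment> \<open>Phrased through pairings instead of \<open>tree_norm\<close>, since
      \<open>l\<close> is not yet known to lie in \<open>tree_space\<close>; this estimate is what
      puts it there.\<close>
    have limit: "\<exists>M. \<forall>m\<ge>M. \<forall>z\<in>polar. \<bar>pairing (\<sigma> m - l) z\<bar> \<le> \<epsilon>" if \<epsilon>: "0 < \<epsilon>" for \<epsilon>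
    proof -
      obtain M where M: "\<forall>m\<ge>M. \<forall>n\<ge>M. tree_norm (\<sigma> m - \<sigma> n) < \<epsilon>"
        using cauchy[OF \<epsilon>] by blast
      have "\<bar>pairing (\<sigma> m - l) z\<bar> \<le> \<epsilon>" if "m \<ge> M" "z \<in> polar" for m z
      proof (rule LIMSEQ_le_const2)
        show "(\<lambda>n. \<bar>pairing (\<sigma> m - \<sigma> n) z\<bar>) \<longlonglongrightarrow> \<bar>pairing (\<sigma> m - l) z\<bar>"
          unfolding pairing_def by (auto intro!: tendsto_intros l)
        have "\<bar>pairing (\<sigma> m - \<sigma> n) z\<bar> \<le> \<epsilon>" if "n \<ge> M" for n
        proof -
          have "\<bar>pairing (\<sigma> m - \<sigma> n) z\<bar> \<le> tree_norm (\<sigma> m - \<sigma> n)"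
            by (intro pairing_le_tree_norm tree_space_diff in_space \<open>z \<in> polar\<close>)
          moreover have "tree_norm (\<sigma> m - \<sigma> n) < \<epsilon>"
            using M \<open>m \<ge> M\<close> that by blast
          ultimately show ?thesis by linarith
        qed
        then show "\<exists>N. \<forall>n\<ge>N. \<bar>pairing (\<sigma> m - \<sigma> n) z\<bar> \<le> \<epsilon>" by blast
      qed
      then show ?thesis by blast
    qed
    have l_in: "l \<in> tree_space"
    proof (rule tree_spaceI)
      fix \<epsilon> :: real assume "0 < \<epsilon>"
      then have half: "0 < \<epsilon> / 2" by simp
      obtain m where m: "\<forall>z\<in>polar. \<bar>pairing (\<sigma> m - l) z\<bar> \<le> \<epsilon> / 2"
        using limit[OF half] by blast
      obtain n where n: "\<And>z. z \<in> polar \<Longrightarrow> \<forall>t<n. z t = 0 \<Longrightarrow> \<bar>pairing (\<sigma> m) z\<bar> \<le> \<epsilon> / 2"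
        using tree_spaceE[OF in_space half] by blast
      have "\<bar>pairing l z\<bar> \<le> \<epsilon>" if "z \<in> polar" "\<forall>t<n. z t = 0" for z
        using bspec[OF m that(1)] n[OF that] unfolding pairing_diff by linarith
      then show "\<exists>n. \<forall>z\<in>polar. (\<forall>t<n. z t = 0) \<longrightarrow> \<bar>pairing l z\<bar> \<le> \<epsilon>" by blast
    qed
    have "\<exists>M. \<forall>m\<ge>M. \<sigma> m \<in> tree_space \<and> ndist tree_space tree_norm (\<sigma> m) l < \<epsilon>"
      if \<epsilon>: "0 < \<epsilon>" for \<epsilon>
    proof -
      obtain M where M: "\<forall>m\<ge>M. \<forall>z\<in>polar. \<bar>pairing (\<sigma> m - l) z\<bar> \<le> \<epsilon> / 2"
        using limit[of "\<epsilon> / 2"] \<epsilon> half_gt_zero by blast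
      have "tree_norm (\<sigma> m - l) \<le> \<epsilon> / 2" if "m \<ge> M" for m
        using M that by (intro tree_norm_le) auto
      then have "\<forall>m\<ge>M. tree_norm (\<sigma> m - l) < \<epsilon>"
        using \<open>0 < \<epsilon>\<close> by fastforce
      then show ?thesis using in_space l_in by (auto simp: ndist_def)
    qed
    then show ?thesis using l_in limit_metric_sequentially by blast
  qed
  then show ?thesis
    by (simp add: banach_space_on_def normed_tree_space mcomplete_def)
qed

section \<open>The unit vectors as a 2-unconditional basis\<close>

lemma sum_units: "finite A \<Longrightarrow> (\<Sum>i\<in>A. a i *\<^sub>R unit i) = restr A a"
  by (induction A rule: finite_induct)
    (auto simp: restr_def unit_def scaleR_fun_def fun_eq_iff)

text \<open>Pairing a tail of \<open>a\<close> with \<open>z\<close> equals pairing \<open>a\<close>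
  with the tail of \<open>z\<close>, which is again polar and vanishes below
  \<open>n\<close>.\<close>

lemma tail_tendsto_0:
  assumes "a \<in> tree_space"
  shows "(\<lambda>n. tree_norm (a - restr {..<n} a)) \<longlonglongrightarrow> 0"
proof (rule LIMSEQ_I)
  fix \<epsilon> :: real assume "0 < \<epsilon>"
  then have half: "0 < \<epsilon> / 2" by simp
  obtain m where m: "\<And>z. z \<in> polar \<Longrightarrow> \<forall>t<m. z t = 0 \<Longrightarrow> \<bar>pairing a z\<bar> \<le> \<epsilon> / 2"
    using tree_spaceE[OF assms half] by blast
  have "norm (tree_norm (a - restr {..<n} a) - 0) < \<epsilon>" if "n \<ge> m" for n
  proof -
    have "a - restr {..<n} a = restr {n..} a"
      by (auto simp: restr_def fun_eq_iff)
    moreover have "tree_norm (restr {n..} a) \<le> \<epsilon> / 2"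
    proof (rule tree_norm_le)
      fix z assume z: "z \<in> polar"
      have "\<bar>pairing a (restr {n..} z)\<bar> \<le> \<epsilon> / 2"
        using that by (intro m restr_polar z) (auto simp: restr_def)
      then show "\<bar>pairing (restr {n..} a) z\<bar> \<le> \<epsilon> / 2"
        using z by (simp add: pairing_tail)
    qed
    moreover have "0 \<le> tree_norm (a - restr {..<n} a)"
      by (intro tree_norm_nonneg tree_space_diff assms restr_tree_space) simp
    ultimately show ?thesis using \<open>0 < \<epsilon>\<close> by simp
  qed
  then show "\<exists>m. \<forall>n\<ge>m. norm (tree_norm (a - restr {..<n} a) - 0) < \<epsilon>" by blast
qed

lemma schauder_tree_space: "schauder_basis_on tree_space tree_norm unit"
  unfolding schauder_basis_on_def
proof (intro conjI ballI)
  show "range unit \<subseteq> tree_space" using unit_tree_space by blast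
next
  fix x assume x: "x \<in> tree_space"
  show "\<exists>!a. (\<lambda>n. tree_norm (x - (\<Sum>i<n. a i *\<^sub>R unit i))) \<longlonglongrightarrow> 0"
  proof (rule ex1I[of _ x])
    show "(\<lambda>n. tree_norm (x - (\<Sum>i<n. x i *\<^sub>R unit i))) \<longlonglongrightarrow> 0"
      using tail_tendsto_0[OF x] by (simp add: sum_units)
  next
    fix a assume a: "(\<lambda>n. tree_norm (x - (\<Sum>i<n. a i *\<^sub>R unit i))) \<longlonglongrightarrow> 0"
    have "\<bar>x t - a t\<bar> \<le> 0" for t
    proof (rule LIMSEQ_le_const[OF a])
      \<comment> \<open>From \<open>n = Suc t\<close> on, the partial sum contains the index
        \<open>t\<close>.\<close>
      have "\<bar>x t - a t\<bar> \<le> tree_norm (x - (\<Sum>i<n. a i *\<^sub>R unit i))" if "n \<ge> Suc t" for n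
        using abs_coord_le[OF tree_space_diff[OF x restr_tree_space[of "{..<n}" a]], of t] that
        by (simp add: sum_units restr_def)
      then show "\<exists>N. \<forall>n\<ge>N. \<bar>x t - a t\<bar> \<le> tree_norm (x - (\<Sum>i<n. a i *\<^sub>R unit i))"
        by blast
    qed
    then show "a = x" by (auto simp: fun_eq_iff)
  qed
qed

text \<open>The work is on the dual side: the modulus of a polar \<open>z\<close>, given the signs
  of \<open>b\<close>, is twice a polar element, and its pairing with \<open>b\<close> dominates
  that of \<open>a\<close> with \<open>z\<close> term by term.\<close>

lemma unconditional_tree_space: "unconditional_basis_on tree_space tree_norm 2 unit"
proof -
  have "tree_norm a \<le> 2 * tree_norm b"
    if fin: "finite {n. a n \<noteq> 0}" "finite {n. b n \<noteq> 0}" and le: "\<And>n. \<bar>a n\<bar> \<le> \<bar>b n\<bar>" for a b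
  proof (rule tree_norm_le)
    fix z assume z: "z \<in> polar"
    let ?w = "\<lambda>t. sgn (b t) * \<bar>z t\<bar>"
    have w: "(1/2) *\<^sub>R ?w \<in> polar"
      by (rule half_sign_change_polar[OF z]) (simp add: abs_mult abs_sgn_eq)
    have supp: "{t. ((1/2) *\<^sub>R ?w) t \<noteq> 0} \<subseteq> {t. z t \<noteq> 0}"
      by (auto simp: scaleR_fun_def)
    have "\<bar>pairing a z\<bar> \<le> (\<Sum>t | z t \<noteq> 0. \<bar>a t * z t\<bar>)"
      unfolding pairing_def by (rule sum_abs)
    also have "\<dots> \<le> (\<Sum>t | z t \<noteq> 0. 2 * (b t * ((1/2) *\<^sub>R ?w) t))"
    proof (rule sum_mono)
      fix t
      have "\<bar>a t * z t\<bar> \<le> \<bar>b t\<bar> * \<bar>z t\<bar>"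
        unfolding abs_mult by (intro mult_right_mono le) simp
      also have "\<bar>b t\<bar> = b t * sgn (b t)" by (rule abs_sgn)
      finally show "\<bar>a t * z t\<bar> \<le> 2 * (b t * ((1/2) *\<^sub>R ?w) t)"
        by (simp add: scaleR_fun_def)
    qed
    also have "\<dots> = 2 * pairing b ((1/2) *\<^sub>R ?w)"
      using pairing_superset[OF polar_finite[OF z] supp] by (simp add: sum_distrib_left)
    also have "\<dots> \<le> 2 * tree_norm b"
      using pairing_le_tree_norm[OF finite_support_tree_space[OF fin(2)] w] by linarith
    finally show "\<bar>pairing a z\<bar> \<le> 2 * tree_norm b" .
  qed
  moreover have "(\<Sum>n | a n \<noteq> 0. a n *\<^sub>R unit n) = a" if "finite {n. a n \<noteq> 0}" for a
    using that by (simp add: sum_units) (simp add: restr_def fun_eq_iff)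
  ultimately show ?thesis
    by (simp add: unconditional_basis_on_def schauder_tree_space)
qed

section \<open>The dual norm\<close>

abbreviation tree_dual :: "((nat \<Rightarrow> real) \<Rightarrow> real) set"
  where "tree_dual \<equiv> dual_space tree_space tree_norm"

abbreviation tree_dual_norm :: "((nat \<Rightarrow> real) \<Rightarrow> real) \<Rightarrow> real"
  where "tree_dual_norm \<equiv> dual_norm tree_space tree_norm"

lemma dual_add: "\<phi> \<in> tree_dual \<Longrightarrow> a \<in> tree_space \<Longrightarrow> b \<in> tree_space \<Longrightarrow> \<phi> (a + b) = \<phi> a + \<phi> b"
  and dual_scaleR: "\<phi> \<in> tree_dual \<Longrightarrow> a \<in> tree_space \<Longrightarrow> \<phi> (c *\<^sub>R a) = c * \<phi> a"
  by (auto simp: dual_space_def)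

lemma dual_diff:
  assumes "\<phi> \<in> tree_dual" "a \<in> tree_space" "b \<in> tree_space"
  shows "\<phi> (a - b) = \<phi> a - \<phi> b"
  using dual_add[OF assms(1,2) tree_space_scaleR[OF assms(3), of "-1"]]
    dual_scaleR[OF assms(1,3), of "-1"] by simp

lemma dual_restr:
  assumes "\<phi> \<in> tree_dual" "finite A"
  shows "\<phi> (restr A a) = (\<Sum>t\<in>A. a t * \<phi> (unit t))"
  using assms(2)
proof (induction A rule: finite_induct)
  case empty
  \<comment> \<open>Writing zero as a scalar multiple lets homogeneity give the value 0.\<close>
  have "restr {} a = 0 *\<^sub>R 0" by (auto simp: restr_def fun_eq_iff)
  then show ?case using dual_scaleR[OF assms(1) tree_space_zero, of 0] by (simp only:) simp
next
  case (insert k A)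
  then have "restr (insert k A) a = a k *\<^sub>R unit k + restr A a"
    by (auto simp: restr_def unit_def scaleR_fun_def fun_eq_iff)
  then have "\<phi> (restr (insert k A) a) = \<phi> (a k *\<^sub>R unit k + restr A a)"
    by (rule arg_cong)
  also have "\<dots> = \<phi> (a k *\<^sub>R unit k) + \<phi> (restr A a)"
    using insert by (intro dual_add assms(1) tree_space_scaleR unit_tree_space restr_tree_space)
  also have "\<phi> (a k *\<^sub>R unit k) = a k * \<phi> (unit k)"
    by (intro dual_scaleR assms(1) unit_tree_space)
  finally show ?case using insert by simp
qed

lemma dual_upper:
  assumes "\<phi> \<in> tree_dual" "a \<in> tree_space" "tree_norm a \<le> 1"
  shows "\<bar>\<phi> a\<bar> \<le> tree_dual_norm \<phi>"
proof -
  obtain C where C: "\<And>x. x \<in> tree_space \<Longrightarrow> \<bar>\<phi> x\<bar> \<le> C * tree_norm x"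
    using assms(1) unfolding dual_space_def by blast
  have "\<bar>\<phi> y\<bar> \<le> \<bar>C\<bar>" if "y \<in> tree_space" "tree_norm y \<le> 1" for y
  proof -
    have "C * tree_norm y \<le> \<bar>C\<bar> * 1"
      using that tree_norm_nonneg by (intro mult_mono) auto
    with C[of y] that show ?thesis by simp
  qed
  then have "bdd_above ((\<lambda>x. \<bar>\<phi> x\<bar>) ` {x \<in> tree_space. tree_norm x \<le> 1})"
    by (intro bdd_aboveI[of _ "\<bar>C\<bar>"]) auto
  then show ?thesis
    unfolding dual_norm_def using assms by (intro cSUP_upper) auto
qed

lemma dual_norm_ge:
  "\<phi> \<in> tree_dual \<Longrightarrow> f \<in> alternating \<Longrightarrow> \<bar>\<phi> f\<bar> \<le> tree_dual_norm \<phi>"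
  by (intro dual_upper alternating_tree_space tree_norm_alternating)

text \<open>With \<open>dual_norm_ge\<close> this identifies the dual norm as the supremum over
  \<open>F\<close>. A one-sided bound suffices because \<open>F\<close> is symmetric. Truncated
  coefficients of \<open>\<phi>\<close> divided by \<open>c\<close> lie in \<open>polar\<close>,
  which bounds \<open>\<phi>\<close> on initial segments of \<open>a\<close>; then the segments
  grow.\<close>

lemma dual_norm_le:
  assumes \<phi>: "\<phi> \<in> tree_dual" and "0 < c" and c: "\<And>f. f \<in> alternating \<Longrightarrow> \<phi> f \<le> c"
  shows "tree_dual_norm \<phi> \<le> c"
proof -
  have abs_le: "\<bar>\<phi> f\<bar> \<le> c" if f: "f \<in> alternating" for f
  proof -
    have "\<phi> (- f) = - \<phi> f"
      using dual_scaleR[OF \<phi> alternating_tree_space[OF f], of "-1"] by simp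
    then show ?thesis
      using c[OF f] c[OF alternating_uminus[OF f]] by linarith
  qed
  obtain C where C: "\<And>x. x \<in> tree_space \<Longrightarrow> \<bar>\<phi> x\<bar> \<le> C * tree_norm x"
    using \<phi> unfolding dual_space_def by blast
  have "\<bar>\<phi> a\<bar> \<le> c" if a: "a \<in> tree_space" "tree_norm a \<le> 1" for a
  proof -
    have head: "\<bar>\<phi> (restr {..<n} a)\<bar> \<le> c" for n
    proof -
      let ?z = "restr {..<n} (\<lambda>t. \<phi> (unit t))"
      have fin: "finite {t. ?z t \<noteq> 0}"
        by (rule finite_subset[of _ "{..<n}"]) (auto simp: restr_def)
      have pair: "pairing b ?z = \<phi> (restr {..<n} b)" for b
      proof -
        have "pairing b ?z = (\<Sum>t<n. b t * ?z t)"
          by (intro pairing_superset) (auto simp: restr_def)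
        also have "\<dots> = \<phi> (restr {..<n} b)"
          by (simp add: dual_restr[OF \<phi>]) (simp add: restr_def)
        finally show ?thesis .
      qed
      \<comment> \<open>Truncating \<open>\<phi>\<close> amounts to restricting \<open>f\<close>,
        and \<open>F\<close> is closed under restriction.\<close>
      have "\<bar>pairing f ((1/c) *\<^sub>R ?z)\<bar> \<le> 1" if "f \<in> alternating" for f
        using abs_le[OF alternating_restr[OF that]] \<open>0 < c\<close>
        by (simp add: pairing_scaleR_right[OF fin] pair abs_mult)
      moreover have "finite {t. ((1/c) *\<^sub>R ?z) t \<noteq> 0}"
        using fin by (rule rev_finite_subset) (auto simp: scaleR_fun_def)
      ultimately have "(1/c) *\<^sub>R ?z \<in> polar"
        by (simp add: polar_def)
      from pairing_le_tree_norm[OF a(1) this] a(2)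
      have "\<bar>pairing a ((1/c) *\<^sub>R ?z)\<bar> \<le> 1" by linarith
      then show ?thesis
        using \<open>0 < c\<close> by (simp add: pairing_scaleR_right[OF fin] pair abs_mult)
    qed
    have "\<bar>\<phi> a\<bar> \<le> c + C * tree_norm (a - restr {..<n} a)" for n
    proof -
      have r: "restr {..<n} a \<in> tree_space" by (simp add: restr_tree_space)
      show ?thesis
        using head[of n] C[OF tree_space_diff[OF a(1) r]] dual_diff[OF \<phi> a(1) r] by linarith
    qed
    moreover have "(\<lambda>n. c + C * tree_norm (a - restr {..<n} a)) \<longlonglongrightarrow> c + C * 0"
      by (intro tendsto_intros tail_tendsto_0 a)
    ultimately show ?thesis
      using LIMSEQ_le_const[of _ "c + C * 0" "\<bar>\<phi> a\<bar>"] by auto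
  qed
  moreover have "0 \<in> {x \<in> tree_space. tree_norm x \<le> 1}"
    using tree_space_zero tree_norm_alternating[OF alternating_zero] by simp
  ultimately show ?thesis
    unfolding dual_norm_def by (intro cSUP_least) auto
qed

section \<open>Functionals along branches\<close>

text \<open>The value 0 outside \<open>tree_space\<close> is the normalisation demanded by
  \<open>dual_space\<close>.\<close>

definition branch_sum :: "(nat \<Rightarrow> bool) \<Rightarrow> (nat \<Rightarrow> real) \<Rightarrow> real"
  where "branch_sum b a = (if a \<in> tree_space then \<Sum>t. restr (branch b) a t else 0)"

text \<open>The witness is the indicator of the finite chain \<open>branch b \<inter> A\<close>. It
  turns partial sums into pairings, to which the tail condition and the norm bound apply.\<close>

lemma branch_partial_sum:
  assumes "finite A"
  obtains z where "z \<in> polar" "\<And>t. t \<notin> A \<Longrightarrow> z t = 0"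
    "\<And>a. pairing a z = (\<Sum>t\<in>A. restr (branch b) a t)"
proof
  let ?z = "restr (branch b \<inter> A) (\<lambda>_. 1)"
  show "?z \<in> polar"
    using assms branch_chain by (intro chain_polar) auto
  show "?z t = 0" if "t \<notin> A" for t
    using that by (simp add: restr_def)
  have "pairing a ?z = (\<Sum>t\<in>A. a t * ?z t)" for a
    using assms by (intro pairing_superset) (auto simp: restr_def)
  then show "pairing a ?z = (\<Sum>t\<in>A. restr (branch b) a t)" for a
    by (simp add: restr_def if_distrib cong: if_cong)
qed

lemma summable_branch:
  assumes "a \<in> tree_space"
  shows "summable (restr (branch b) a)"
  unfolding summable_Cauchy
proof (intro allI impI)
  fix \<epsilon> :: real assume "0 < \<epsilon>"
  then have half: "0 < \<epsilon> / 2" by simp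
  obtain N where N: "\<And>z. z \<in> polar \<Longrightarrow> \<forall>t<N. z t = 0 \<Longrightarrow> \<bar>pairing a z\<bar> \<le> \<epsilon> / 2"
    using tree_spaceE[OF assms half] by blast
  have "norm (sum (restr (branch b) a) {m..<n}) < \<epsilon>" if "m \<ge> N" for m n
  proof -
    obtain z where z: "z \<in> polar" "\<And>t. t \<notin> {m..<n} \<Longrightarrow> z t = 0"
      "\<And>a. pairing a z = sum (restr (branch b) a) {m..<n}"
      using branch_partial_sum[of "{m..<n}" b] by blast
    have "\<bar>pairing a z\<bar> \<le> \<epsilon> / 2"
      using z(2) that by (intro N z(1)) auto
    then show ?thesis using z(3) \<open>0 < \<epsilon>\<close> by simp
  qed
  then show "\<exists>N. \<forall>m\<ge>N. \<forall>n. norm (sum (restr (branch b) a) {m..<n}) < \<epsilon>" by blast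
qed

lemma branch_sum_dual: "branch_sum b \<in> tree_dual"
proof -
  have "branch_sum b (x + y) = branch_sum b x + branch_sum b y"
    if "x \<in> tree_space" "y \<in> tree_space" for x y
  proof -
    have "restr (branch b) (x + y) = (\<lambda>t. restr (branch b) x t + restr (branch b) y t)"
      by (auto simp: restr_def fun_eq_iff)
    then show ?thesis
      using that by (simp add: branch_sum_def tree_space_add suminf_add summable_branch)
  qed
  moreover have "branch_sum b (c *\<^sub>R x) = c * branch_sum b x" if "x \<in> tree_space" for c x
  proof -
    have "restr (branch b) (c *\<^sub>R x) = (\<lambda>t. c * restr (branch b) x t)"
      by (auto simp: restr_def scaleR_fun_def fun_eq_iff)
    then show ?thesis
      using that by (simp add: branch_sum_def tree_space_scaleR suminf_mult summable_branch)
  qed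
  moreover have "\<bar>branch_sum b x\<bar> \<le> 1 * tree_norm x" if x: "x \<in> tree_space" for x
  proof (rule LIMSEQ_le_const2)
    show "(\<lambda>n. \<bar>\<Sum>t<n. restr (branch b) x t\<bar>) \<longlonglongrightarrow> \<bar>branch_sum b x\<bar>"
      using summable_LIMSEQ[OF summable_branch[OF x, of b]] x
      by (intro tendsto_rabs) (simp add: branch_sum_def)
    have "\<bar>\<Sum>t<n. restr (branch b) x t\<bar> \<le> 1 * tree_norm x" for n
      using branch_partial_sum[of "{..<n}" b] pairing_le_tree_norm[OF x]
      by (metis finite_lessThan mult_1)
    then show "\<exists>N. \<forall>n\<ge>N. \<bar>\<Sum>t<n. restr (branch b) x t\<bar> \<le> 1 * tree_norm x" by blast
  qed
  moreover have "branch_sum b x = 0" if "x \<notin> tree_space" for x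
    using that by (simp add: branch_sum_def)
  ultimately show ?thesis
    unfolding dual_space_def by blast
qed

lemma branch_sum_finite:
  assumes "finite A" "{t. a t \<noteq> 0} \<subseteq> A"
  shows "branch_sum b a = sum a (branch b \<inter> A)"
proof -
  have "a \<in> tree_space"
    using assms by (intro finite_support_tree_space) (rule finite_subset)
  then have "branch_sum b a = (\<Sum>t. restr (branch b) a t)"
    by (simp add: branch_sum_def)
  also have "\<dots> = (\<Sum>t\<in>branch b \<inter> A. restr (branch b) a t)"
    using assms by (intro suminf_finite) (auto simp: restr_def)
  also have "\<dots> = sum a (branch b \<inter> A)"
    by (intro sum.cong) (auto simp: restr_def)
  finally show ?thesis .
qed

lemma branch_sum_unit: "branch_sum b (unit k) = (if k \<in> branch b then 1 else 0)"
  using branch_sum_finite[of "{k}" "unit k" b] by (auto simp: unit_def)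

lemma branch_sum_le_1:
  assumes "f \<in> alternating"
  shows "branch_sum b f \<le> 1"
proof -
  have fin: "finite {t. f t \<noteq> 0}" by (rule alternating_finite[OF assms])
  have "sum f (branch b \<inter> {t. f t \<noteq> 0}) \<le> 1"
    by (rule chain_sum_le(1)[OF assms]) (use fin branch_chain in auto)
  then show ?thesis using branch_sum_finite[OF fin, of f b] by simp
qed

lemma dual_norm_branch_sum: "tree_dual_norm (branch_sum b) = 1"
proof (rule antisym)
  show "tree_dual_norm (branch_sum b) \<le> 1"
    by (intro dual_norm_le branch_sum_dual branch_sum_le_1) simp
  have "0 \<in> branch b" by (simp add: branch_def)
  then show "1 \<le> tree_dual_norm (branch_sum b)"
    using dual_norm_ge[OF branch_sum_dual alternating_unit, of b 0] by (simp add: branch_sum_unit)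
qed

text \<open>A negative value on the branch would force a nonpositive branch sum, so \<open>f\<close>
  is nonnegative there. Nodes of the support comparable with \<open>k\<close> are smaller than
  \<open>k\<close>, hence below it and on the branch, and the new value -1 conflicts with none of
  them.\<close>

lemma alternating_extend:
  assumes f: "f \<in> alternating" and pos: "0 < branch_sum b f"
    and k: "k \<in> branch b" "\<And>t. f t \<noteq> 0 \<Longrightarrow> t < k"
  shows "f - unit k \<in> alternating"
proof -
  let ?S = "{t. f t \<noteq> 0}"
  have fk: "f k = 0" using k(2) by blast
  have fin: "finite ?S" by (rule alternating_finite[OF f])
  have nonneg: "0 \<le> f s" if "s \<in> branch b" for s
  proof (rule ccontr)
    assume neg: "\<not> 0 \<le> f s"
    have "sum f (branch b \<inter> ?S) \<le> 0"
      by (rule chain_sum_le(2)[OF f]) (use that neg fin branch_chain in auto)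
    with pos show False using branch_sum_finite[OF fin, of f b] by simp
  qed
  have comp: "0 \<le> f s" if "comparable s k \<or> comparable k s" for s
  proof (cases "f s = 0")
    case False
    then have "s < k" by (rule k(2))
    then have "below s k" using that below_le[of k s] by (auto simp: comparable_def)
    then show ?thesis using branch_down_closed[OF k(1)] nonneg by blast
  qed simp
  have "finite {t. (f - unit k) t \<noteq> 0}"
    by (rule finite_subset[of _ "insert k ?S"]) (use fin in \<open>auto simp: unit_def\<close>)
  moreover have "(f - unit k) t \<in> {-1, 0, 1}" for t
    using alternating_values[OF f, of t] fk by (auto simp: unit_def)
  moreover have "(f - unit k) s * (f - unit k) t \<le> 0" if "s \<noteq> t" "comparable s t" for s t
    using alternating_mult[OF f that] comp[of s] comp[of t] that fk by (auto simp: unit_def)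
  ultimately show ?thesis by (simp add: alternating_def)
qed

section \<open>Functionals whose coordinates tend to zero along a branch\<close>

definition vanishes_along :: "((nat \<Rightarrow> real) \<Rightarrow> real) \<Rightarrow> (nat \<Rightarrow> bool) \<Rightarrow> bool" where
  "vanishes_along \<phi> b \<longleftrightarrow> (\<forall>\<epsilon>>0. finite {t \<in> branch b. \<epsilon> \<le> \<bar>\<phi> (unit t)\<bar>})"

lemma dual_norm_diff_branch_sum:
  assumes \<phi>: "\<phi> \<in> tree_dual" and small: "vanishes_along \<phi> b"
  shows "tree_dual_norm \<phi> \<le> tree_dual_norm (\<phi> - branch_sum b)"
proof (rule field_le_epsilon)
  fix \<epsilon> :: real assume "0 < \<epsilon>"
  let ?\<psi> = "\<phi> - branch_sum b"
  have \<psi>: "?\<psi> \<in> tree_dual"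
    using normed_space_on_dual[OF normed_tree_space] \<phi> branch_sum_dual
    by (simp add: normed_space_on_def subspace_diff)
  have "0 \<le> tree_dual_norm ?\<psi>"
    using dual_norm_ge[OF \<psi> alternating_zero] by linarith
  with \<open>0 < \<epsilon>\<close> have "0 < tree_dual_norm ?\<psi> + \<epsilon>" by linarith
  then show "tree_dual_norm \<phi> \<le> tree_dual_norm ?\<psi> + \<epsilon>"
  proof (rule dual_norm_le[OF \<phi>])
    fix f assume f: "f \<in> alternating"
    show "\<phi> f \<le> tree_dual_norm ?\<psi> + \<epsilon>"
    proof (cases "0 < branch_sum b f")
      \<comment> \<open>Subtracting a nonpositive branch sum cannot decrease the value at
        \<open>f\<close>.\<close>
      case False
      then show ?thesis using dual_norm_ge[OF \<psi> f] \<open>0 < \<epsilon>\<close> by simp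
    next
      case True
      obtain n where n: "{t. f t \<noteq> 0} \<subseteq> {..<n}"
        using alternating_finite[OF f] finite_nat_iff_bounded by blast
      \<comment> \<open>Removing two finite sets from an infinite branch leaves a node
        \<open>k\<close> beyond the support of \<open>f\<close> with small coefficient.\<close>
      have "infinite (branch b - {t \<in> branch b. \<epsilon> \<le> \<bar>\<phi> (unit t)\<bar>} - {..<n})"
        using small \<open>0 < \<epsilon>\<close> infinite_branch by (auto simp: vanishes_along_def)
      then obtain k where k: "k \<in> branch b" "\<bar>\<phi> (unit k)\<bar> < \<epsilon>" "n \<le> k"
        by (metis (no_types, lifting) DiffE finite.emptyI ex_in_conv lessThan_iff linorder_not_le mem_Collect_eq)
      have g: "f - unit k \<in> alternating"
        using f True k(1) by (rule alternating_extend) (use n k(3) in fastforce)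
      \<comment> \<open>The gain of 1 at \<open>k\<close> compensates
        \<open>branch_sum b f \<le> 1\<close>, and only \<open>\<phi> (unit k)\<close>, of modulus
        below \<open>\<epsilon>\<close>, is lost.\<close>
      have "?\<psi> (f - unit k) = (\<phi> f - branch_sum b f) - (\<phi> (unit k) - branch_sum b (unit k))"
        using dual_diff[OF \<phi> alternating_tree_space[OF f] unit_tree_space, of k]
          dual_diff[OF branch_sum_dual alternating_tree_space[OF f] unit_tree_space, of b k] by simp
      also have "branch_sum b (unit k) = 1" using k(1) by (simp add: branch_sum_unit)
      finally show ?thesis
        using branch_sum_le_1[OF f, of b] k(2) dual_norm_ge[OF \<psi> g] by linarith
    qed
  qed
qed

text \<open>Beyond the finitely many nodes shared by branches of \<open>B\<close>, pick one large
  coefficient on each branch. Branches are closed downwards, so the picked nodes form an antichain;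
  the signs of \<open>\<phi>\<close> on it give an element of \<open>F\<close> at which the moduli
  add up.\<close>

lemma large_branches_card:
  assumes \<phi>: "\<phi> \<in> tree_dual" and "0 < \<epsilon>" and "finite B"
    and large: "\<And>b. b \<in> B \<Longrightarrow> infinite {t \<in> branch b. \<epsilon> \<le> \<bar>\<phi> (unit t)\<bar>}"
  shows "real (card B) * \<epsilon> \<le> tree_dual_norm \<phi>"
proof -
  have "finite (\<Union>b\<in>B. \<Union>c\<in>B - {b}. branch b \<inter> branch c)"
    using \<open>finite B\<close> by (intro finite_UN_I branch_almost_disjoint) auto
  then obtain n where n: "(\<Union>b\<in>B. \<Union>c\<in>B - {b}. branch b \<inter> branch c) \<subseteq> {..<n}"
    using finite_nat_iff_bounded by blast
  have "\<exists>t. t \<in> branch b \<and> \<epsilon> \<le> \<bar>\<phi> (unit t)\<bar> \<and> n \<le> t" if "b \<in> B" for b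
    using large[OF that] unfolding infinite_nat_iff_unbounded_le by blast
  then obtain \<tau> where \<tau>: "\<And>b. b \<in> B \<Longrightarrow> \<tau> b \<in> branch b"
    "\<And>b. b \<in> B \<Longrightarrow> \<epsilon> \<le> \<bar>\<phi> (unit (\<tau> b))\<bar>" "\<And>b. b \<in> B \<Longrightarrow> n \<le> \<tau> b"
    by metis
  have not_below: "\<not> below (\<tau> b) (\<tau> c)" if "b \<in> B" "c \<in> B" "b \<noteq> c" for b c
  proof
    assume "below (\<tau> b) (\<tau> c)"
    then have "\<tau> b \<in> branch b \<inter> branch c"
      using \<tau>(1) that branch_down_closed by blast
    then have "\<tau> b < n" using n that by blast
    with \<tau>(3)[OF that(1)] show False by linarith
  qed
  have eq: "b = c" if "b \<in> B" "c \<in> B" "comparable (\<tau> b) (\<tau> c)" for b c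
    using not_below that unfolding comparable_def by metis
  have refl: "comparable t t" for t
    unfolding comparable_def below_def by (metis div_by_1 power_0)
  have inj: "inj_on \<tau> B"
    using eq refl by (metis inj_onI)
  let ?f = "restr (\<tau> ` B) (\<lambda>t. sgn (\<phi> (unit t)))"
  have f: "?f \<in> alternating"
    by (rule alternating_antichain) (use \<open>finite B\<close> eq in \<open>auto simp: sgn_real_def\<close>)
  have "real (card B) * \<epsilon> \<le> (\<Sum>b\<in>B. \<bar>\<phi> (unit (\<tau> b))\<bar>)"
    using \<tau>(2) by (rule sum_bounded_below)
  also have "\<dots> = (\<Sum>t\<in>\<tau> ` B. \<bar>\<phi> (unit t)\<bar>)"
    by (simp add: sum.reindex[OF inj])
  also have "\<dots> = \<phi> ?f"
    using \<open>finite B\<close> by (simp add: dual_restr[OF \<phi>] abs_sgn mult.commute)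
  also have "\<dots> \<le> tree_dual_norm \<phi>"
    using dual_norm_ge[OF \<phi> f] by linarith
  finally show ?thesis .
qed

text \<open>For each threshold the preceding count leaves only finitely many bad branches; the
  thresholds \<open>1 / (k + 1)\<close> exhaust all cases.\<close>

lemma countable_not_vanishing:
  assumes \<phi>: "\<phi> \<in> tree_dual"
  shows "countable {b. \<not> vanishes_along \<phi> b}"
proof -
  let ?L = "\<lambda>\<epsilon>. {b. infinite {t \<in> branch b. \<epsilon> \<le> \<bar>\<phi> (unit t)\<bar>}}"
  have fin: "finite (?L \<epsilon>)" if \<epsilon>: "0 < \<epsilon>" for \<epsilon>
  proof (rule ccontr)
    assume inf: "infinite (?L \<epsilon>)"
    obtain m :: nat where m: "tree_dual_norm \<phi> < real m * \<epsilon>"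
      using spec[OF reals_Archimedean3[OF \<epsilon>], of "tree_dual_norm \<phi>"] by (rule exE)
    obtain B where B: "B \<subseteq> ?L \<epsilon>" "card B = m" "finite B"
      using infinite_arbitrarily_large[OF inf, of m] by blast
    have "real (card B) * \<epsilon> \<le> tree_dual_norm \<phi>"
      by (rule large_branches_card[OF \<phi> \<epsilon> B(3)]) (use B(1) in blast)
    with m B(2) show False by simp
  qed
  have "{b. \<not> vanishes_along \<phi> b} \<subseteq> (\<Union>k. ?L (inverse (real (Suc k))))"
  proof
    fix b assume "b \<in> {b. \<not> vanishes_along \<phi> b}"
    then obtain \<epsilon> where "0 < \<epsilon>" and inf: "infinite {t \<in> branch b. \<epsilon> \<le> \<bar>\<phi> (unit t)\<bar>}"
      by (auto simp: vanishes_along_def)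
    obtain k where k: "inverse (real (Suc k)) < \<epsilon>"
      using reals_Archimedean[OF \<open>0 < \<epsilon>\<close>] by blast
    have "infinite {t \<in> branch b. inverse (real (Suc k)) \<le> \<bar>\<phi> (unit t)\<bar>}"
      using inf by (rule infinite_super[rotated]) (use k in auto)
    then show "b \<in> (\<Union>k. ?L (inverse (real (Suc k))))" by blast
  qed
  moreover have "countable (\<Union>k. ?L (inverse (real (Suc k))))"
    by (rule countable_UN[OF _ countable_finite[OF fin]]) simp_all
  ultimately show ?thesis by (rule countable_subset)
qed

section \<open>Failure of the ball-covering property\<close>

lemma tree_dual_not_BCP: "\<not> BCP_on tree_dual tree_dual_norm"
proof
  assume "BCP_on tree_dual tree_dual_norm"
  then obtain B where B: "countable B"
    "\<And>z r. (z, r) \<in> B \<Longrightarrow> z \<in> tree_dual \<and> r \<le> tree_dual_norm z"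
    and cover: "{x \<in> tree_dual. tree_dual_norm x = 1}
      \<subseteq> (\<Union>(z, r)\<in>B. Metric_space.mball tree_dual (ndist tree_dual tree_dual_norm) z r)"
    unfolding BCP_on_def by blast
  \<comment> \<open>Each centre excludes countably many branches, so one branch suits all centres at
    once.\<close>
  have "countable (\<Union>(z, r)\<in>B. {b. \<not> vanishes_along z b})"
    by (rule countable_UN[OF B(1)]) (use B(2) countable_not_vanishing in auto)
  then have "(\<Union>(z, r)\<in>B. {b. \<not> vanishes_along z b}) \<noteq> UNIV"
    using uncountable_cantor_space by metis
  then obtain b where b: "\<And>z r. (z, r) \<in> B \<Longrightarrow> vanishes_along z b" by blast
  have "branch_sum b \<in> {x \<in> tree_dual. tree_dual_norm x = 1}"
    by (simp add: branch_sum_dual dual_norm_branch_sum)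
  then obtain z r where zr: "(z, r) \<in> B"
    and "branch_sum b \<in> Metric_space.mball tree_dual (ndist tree_dual tree_dual_norm) z r"
    using cover by blast
  then have "tree_dual_norm (z - branch_sum b) < r"
    unfolding Metric_space.in_mball[OF Metric_space_ndist[OF normed_space_on_dual[OF normed_tree_space]]]
    using branch_sum_dual by (auto simp: ndist_def split: if_splits)
  moreover have "tree_dual_norm z \<le> tree_dual_norm (z - branch_sum b)"
    using B(2)[OF zr] b[OF zr] by (intro dual_norm_diff_branch_sum) auto
  ultimately show False using B(2)[OF zr] by linarith
qed

theorem proposition3p5:
  shows "\<exists>(X :: (nat \<Rightarrow> real) set) (N :: (nat \<Rightarrow> real) \<Rightarrow> real).
           banach_space_on X N \<and>
           (\<exists>e :: nat \<Rightarrow> nat \<Rightarrow> real. unconditional_basis_on X N 2 e) \<and>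
           \<not> BCP_on (dual_space X N) (dual_norm X N)"
  using banach_tree_space unconditional_tree_space tree_dual_not_BCP by blast

end
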